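(* Let $\beta>0$ and let $N_t$ be the self-exciting point process with intensity $\lambda_t=\beta+\frac{N_{t-}}{t+1}$. Then for all $t\ge 0$, $$\mathbb{E}[N_t]=\beta(t+1)\log(t+1),\qquad \mathrm{Var}[N_t]=-\beta(t+1)\log(t+1)+2\beta t(t+1),$$ and $$\lim_{t\to\infty}\frac{\mathrm{Var}[N_t]}{t^2}=2\beta .$$
   Context: $N_t$ is a simple point process on $(0,\infty)$ with $N_0=0$ (empty past history) whose intensity at time $t$ with respect to its natural filtration is $\lambda_t=\lambda\left(\frac{N_{t-}}{t+1}\right)$ with $\lambda(z)=\beta+z$. *)

theory Defs
  imports "HOL-Probability.Probability"
begin

text \<open>
  A point process on \<open>(0, \<infinity>)\<close> is given by its counting process: \<open>N t \<omega>\<close> is the number of points in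
  \<open>(0, t]\<close>. Having values in \<^typ>\<open>nat\<close> makes it locally finite, i.e. non-explosive. Time ranges over
  \<^typ>\<open>real\<close>, and an empty past history means that \<open>N\<close> vanishes up to and including time 0.
\<close>

definition left_lim :: "(real \<Rightarrow> real) \<Rightarrow> real \<Rightarrow> real" where
  "left_lim f t = Lim (at_left t) f"

locale simple_point_process = prob_space M
  for M :: "'a measure" +
  fixes N :: "real \<Rightarrow> 'a \<Rightarrow> nat"
  assumes N_measurable: "\<And>t. N t \<in> M \<rightarrow>\<^sub>M count_space UNIV"
    and N_past: "\<And>t \<omega>. \<omega> \<in> space M \<Longrightarrow> t \<le> 0 \<Longrightarrow> N t \<omega> = 0"
    and N_mono: "\<And>\<omega>. \<omega> \<in> space M \<Longrightarrow> mono (\<lambda>t. N t \<omega>)"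
    and N_right_cont: "\<And>t \<omega>. \<omega> \<in> space M \<Longrightarrow> continuous (at_right t) (\<lambda>s. real (N s \<omega>))"
    and N_simple: "\<And>t \<omega>. \<omega> \<in> space M \<Longrightarrow> real (N t \<omega>) - left_lim (\<lambda>s. real (N s \<omega>)) t \<le> 1"

definition natural_filtration :: "'a measure \<Rightarrow> (real \<Rightarrow> 'a \<Rightarrow> nat) \<Rightarrow> real \<Rightarrow> 'a measure" where
  "natural_filtration M N t = sigma (space M) {N s -` B \<inter> space M | s B. s \<le> t}"

definition predictable_sigma :: "'a measure \<Rightarrow> (real \<Rightarrow> 'a measure) \<Rightarrow> (real \<times> 'a) measure" where
  "predictable_sigma M F =
     sigma ({0<..} \<times> space M) {{r<..s} \<times> A | r s A. 0 \<le> r \<and> r \<le> s \<and> A \<in> sets (F r)}"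

text \<open>
  \<open>lam\<close> is a stochastic intensity of \<open>N\<close> with respect to \<open>F\<close>: it is nonnegative, progressively
  measurable and almost surely locally integrable, and
  \<open>E (\<integral> C\<^sub>s dN\<^sub>s) = E (\<integral> C\<^sub>s \<lambda>\<^sub>s ds)\<close> (over \<open>(0, \<infinity>)\<close>) for every nonnegative predictable \<open>C\<close>. Choosing \<open>C\<close> as
  the indicator of \<open>(a, b] \<times> A\<close> with \<open>A \<in> F a\<close> gives
  \<open>E (N b - N a | F a) = E (\<integral>\<^bsub>(a, b]\<^esub> \<lambda>\<^sub>s ds | F a)\<close>. No integrability of \<open>N t\<close> is assumed; requiring
  only the latter identity, with infinite values allowed, would not determine the intensity.
\<close>

definition has_intensity ::
  "'a measure \<Rightarrow> (real \<Rightarrow> 'a measure) \<Rightarrow> (real \<Rightarrow> 'a \<Rightarrow> nat) \<Rightarrow> (real \<Rightarrow> 'a \<Rightarrow> real) \<Rightarrow> bool" where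
  "has_intensity M F N lam \<longleftrightarrow>
     (\<forall>t\<ge>0. \<forall>\<omega>\<in>space M. 0 \<le> lam t \<omega>) \<and>
     (\<forall>t\<ge>0. (\<lambda>(s, \<omega>). lam s \<omega>) \<in> borel_measurable (restrict_space borel {0..t} \<Otimes>\<^sub>M F t)) \<and>
     (\<forall>t\<ge>0. AE \<omega> in M. (\<integral>\<^sup>+ s\<in>{0..t}. ennreal (lam s \<omega>) \<partial>lborel) < \<infinity>) \<and>
     (\<forall>C :: real \<Rightarrow> 'a \<Rightarrow> ennreal.
        (\<lambda>(s, \<omega>). C s \<omega>) \<in> borel_measurable (predictable_sigma M F) \<longrightarrow>
        (\<integral>\<^sup>+ \<omega>. (\<integral>\<^sup>+ s\<in>{0<..}. C s \<omega> \<partial>interval_measure (\<lambda>t. real (N t \<omega>))) \<partial>M) =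
        (\<integral>\<^sup>+ \<omega>. (\<integral>\<^sup>+ s\<in>{0<..}. C s \<omega> * ennreal (lam s \<omega>) \<partial>lborel) \<partial>M))"

end

theory Submission
  imports Defs "HOL-Real_Asymp.Real_Asymp"
begin

text \<open>
  Testing the intensity against the predictable process \<open>w (N\<^bsub>s-\<^esub>)\<close> gives Dynkin's formula for the
  test function \<open>n \<mapsto> \<Sum>k<n. w k\<close>. The weights \<open>w k = 1\<close> and \<open>w k = 2 * k + 1\<close> give the first and
  second moments \<open>m\<close> and \<open>S\<close>, which satisfy
  \<open>m' = \<beta> + m / (t + 1)\<close> and \<open>S' = \<beta> + (2 * \<beta> + 1 / (t + 1)) * m + 2 * S / (t + 1)\<close>.
  The moments are first shown to be finite, by truncation; then they are locally Lipschitz in time,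
  so \<open>N\<^bsub>s-\<^esub>\<close> and \<open>N\<^bsub>s\<^esub>\<close> have the same moments and the equations close.
\<close>

text \<open>Each fibre is a difference of two strict superlevel sets. The criterion suits
  \<open>left_count\<close>, whose superlevel sets are countable unions of rectangles.\<close>

lemma measurable_nat_greaterI:
  fixes f :: "'b \<Rightarrow> nat"
  assumes "\<And>k. {x \<in> space M. k < f x} \<in> sets M"
  shows "f \<in> M \<rightarrow>\<^sub>M count_space UNIV"
proof (subst measurable_count_space_eq2_countable)
  have "f -` {k} \<inter> space M \<in> sets M" for k
  proof (cases k)
    case 0
    have "f -` {k} \<inter> space M = space M - {x \<in> space M. 0 < f x}"
      using 0 by auto
    then show ?thesis using assms[of 0] by simp
  next
    case (Suc j)
    have "f -` {k} \<inter> space M = {x \<in> space M. j < f x} - {x \<in> space M. Suc j < f x}"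
      using Suc by auto
    then show ?thesis using assms by simp
  qed
  then show "f \<in> space M \<rightarrow> UNIV \<and> (\<forall>a\<in>UNIV. f -` {a} \<inter> space M \<in> sets M)"
    by simp
qed

section \<open>Left limits, passage times and integrals along a single path\<close>

context simple_point_process
begin

text \<open>The left limit of the path as a natural number rather than a real, so that it can index
  weights. For outcomes in \<open>space M\<close> the values are bounded by
  \<open>N s \<omega>\<close>, so the supremum is a maximum.\<close>

definition left_count :: "real \<Rightarrow> 'a \<Rightarrow> nat" where
  "left_count s \<omega> = (SUP r\<in>{..<s}. N r \<omega>)"

context
  fixes \<omega> assumes \<omega>: "\<omega> \<in> space M"
begin

lemma N_le: "r \<le> s \<Longrightarrow> N r \<omega> \<le> N s \<omega>"
  using N_mono[OF \<omega>] by (auto simp: mono_def)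

lemma bdd_above_past: "bdd_above ((\<lambda>r. N r \<omega>) ` {..<s})"
  by (rule bdd_aboveI[of _ "N s \<omega>"]) (auto intro: N_le)

lemma N_le_left_count: "r < s \<Longrightarrow> N r \<omega> \<le> left_count s \<omega>"
  unfolding left_count_def by (rule cSUP_upper[OF _ bdd_above_past]) auto

lemma left_count_attained: "\<exists>r<s. N r \<omega> = left_count s \<omega>"
proof -
  let ?X = "(\<lambda>r. N r \<omega>) ` {..<s}"
  have "Sup ?X \<in> ?X"
    using bdd_above_past[of s] lt_ex[of s]
    by (auto simp: Sup_nat_def bdd_above_nat intro!: Max_in simp del: Max_in)
  then show ?thesis by (auto simp: left_count_def)
qed

lemma left_count_le: "left_count s \<omega> \<le> N s \<omega>"
  using left_count_attained[of s] N_le by (metis less_imp_le)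

text \<open>After a time \<open>r < s\<close> at which the supremum is attained, the path stays
  constant until \<open>s\<close>, so this is the limit of an eventually constant function.\<close>

lemma left_lim_eq_left_count: "left_lim (\<lambda>s. real (N s \<omega>)) s = real (left_count s \<omega>)"
proof -
  obtain r where r: "r < s" "N r \<omega> = left_count s \<omega>"
    using left_count_attained by blast
  have "N x \<omega> = left_count s \<omega>" if "r < x" "x < s" for x
    using N_le[of r x] N_le_left_count[of x s] that r by simp
  then have "eventually (\<lambda>x. real (N x \<omega>) = real (left_count s \<omega>)) (at_left s)"
    using r(1) by (auto intro!: eventually_at_leftI[of r])
  then have "((\<lambda>x. real (N x \<omega>)) \<longlongrightarrow> real (left_count s \<omega>)) (at_left s)"
    by (rule tendsto_eventually)
  then show ?thesis
    unfolding left_lim_def by (intro tendsto_Lim) auto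
qed

text \<open>Simplicity of the process enters here: a path never skips a level.\<close>

lemma N_le_Suc_left_count: "N s \<omega> \<le> Suc (left_count s \<omega>)"
  using N_simple[OF \<omega>, of s] unfolding left_lim_eq_left_count by linarith

text \<open>By monotonicity, a rational time squeezed in before \<open>s\<close> already exceeds
  \<open>k\<close>, which makes superlevel sets countable unions. Negative times drop out because
  the count vanishes there; the predictable generators need nonnegative times.\<close>

lemma less_left_count_iff:
  "k < left_count s \<omega> \<longleftrightarrow> (\<exists>q\<in>\<rat> \<inter> {0..}. q < s \<and> k < N q \<omega>)"
proof
  assume "k < left_count s \<omega>"
  then obtain r where r: "r < s" "k < N r \<omega>"
    using left_count_attained by metis
  obtain q where q: "q \<in> \<rat>" "r < q" "q < s"
    using Rats_dense_in_real[OF r(1)] by blast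
  have "k < N q \<omega>"
    using r(2) N_le[of r q] q by simp
  moreover from this have "0 \<le> q"
    using N_past[OF \<omega>, of q] by force
  ultimately show "\<exists>q\<in>\<rat> \<inter> {0..}. q < s \<and> k < N q \<omega>"
    using q by auto
qed (use N_le_left_count in force)

text \<open>\<open>T\<close> is the infimum of the times at which the count exceeds
  \<open>k\<close>. Right continuity puts \<open>T\<close> itself into this set, and unit jumps
  exclude values above \<open>Suc k\<close>.\<close>

lemma first_passage:
  assumes "k < N t \<omega>"
  obtains T where "0 < T" "T \<le> t" "\<And>s. k < N s \<omega> \<longleftrightarrow> T \<le> s" "N T \<omega> = Suc k"
proof -
  let ?S = "{s. k < N s \<omega>}"
  define T where "T = Inf ?S"
  have bdd: "bdd_below ?S"
    using N_past[OF \<omega>] by (intro bdd_belowI[of _ 0]) (metis mem_Collect_eq nle_le not_less0)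
  have "((\<lambda>s. real (N s \<omega>)) \<longlongrightarrow> real (N T \<omega>)) (at_right T)"
    using N_right_cont[OF \<omega>, of T] by (simp add: continuous_within)
  \<comment> \<open>Natural numbers at distance below 1 coincide, so the path is constant just after
    \<open>T\<close>.\<close>
  then have "eventually (\<lambda>s. dist (real (N s \<omega>)) (real (N T \<omega>)) < 1) (at_right T)"
    by (rule tendstoD) simp
  then obtain b where b: "T < b" "\<And>s. T < s \<Longrightarrow> s < b \<Longrightarrow> dist (real (N s \<omega>)) (real (N T \<omega>)) < 1"
    by (auto simp: eventually_at_right_field)
  have NT: "k < N T \<omega>"
  proof -
    obtain s where s: "s \<in> ?S" "s < b"
      using cInf_lessD[of ?S b] assms b(1) unfolding T_def by blast
    have "T \<le> s"
      unfolding T_def using s bdd by (intro cInf_lower) auto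
    then show ?thesis
      using b(2)[of s] s by (cases "s = T") (auto simp: dist_real_def)
  qed
  have iff: "k < N s \<omega> \<longleftrightarrow> T \<le> s" for s
    using NT N_le[of T s] bdd unfolding T_def by (auto intro: cInf_lower less_le_trans)
  have "0 < T"
    using NT N_past[OF \<omega>, of T] by force
  moreover have "N T \<omega> = Suc k"
  proof -
    have "left_count T \<omega> \<le> k"
      using left_count_attained[of T] iff by (metis not_le)
    then show ?thesis
      using N_le_Suc_left_count[of T] NT by simp
  qed
  ultimately show thesis
    using that iff assms by blast
qed

lemma emeasure_path_Ioc:
  "a \<le> b \<Longrightarrow> emeasure (interval_measure (\<lambda>t. real (N t \<omega>))) {a<..b} = ennreal (real (N b \<omega>) - real (N a \<omega>))"
  by (rule emeasure_interval_measure_Ioc) (use N_le N_right_cont[OF \<omega>] in auto)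

text \<open>The set ends at the passage time above level \<open>k\<close>, or at \<open>t\<close> if
  that level is not exceeded by then. The passage time belongs to the set, since the left limit
  there is still at most \<open>k\<close>.\<close>

lemma left_count_le_set:
  assumes "0 \<le> t"
  obtains b where "0 \<le> b" "{s\<in>{0<..t}. left_count s \<omega> \<le> k} = {0<..b}" "N b \<omega> = min (N t \<omega>) (Suc k)"
proof (cases "k < N t \<omega>")
  case True
  then obtain T where T: "0 < T" "T \<le> t" "\<And>s. k < N s \<omega> \<longleftrightarrow> T \<le> s" "N T \<omega> = Suc k"
    using first_passage[OF True] by blast
  have "left_count s \<omega> \<le> k \<longleftrightarrow> s \<le> T" for s
    using left_count_attained[of s] N_le_left_count[of T s] T(3) by (metis not_le less_le_trans not_less_iff_gr_or_eq)
  moreover have "min (N t \<omega>) (Suc k) = Suc k"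
    using True by simp
  ultimately show ?thesis
    using T by (intro that[of T]) auto
next
  case False
  have "left_count s \<omega> \<le> k" if "s \<le> t" for s
    using left_count_le[of s] N_le[OF that] False by simp
  then show ?thesis
    using False assms by (intro that[of t]) auto
qed

text \<open>The level set is a difference of two initial intervals, so its mass is
  \<open>min (N t \<omega>) (Suc k) - min (N t \<omega>) k\<close>: the path leaves level
  \<open>k\<close> by a single unit jump, if at all.\<close>

lemma emeasure_left_count_eq:
  assumes "0 \<le> t"
  shows "{s\<in>{0<..t}. left_count s \<omega> = k} \<in> sets borel"
    and "emeasure (interval_measure (\<lambda>t. real (N t \<omega>))) {s\<in>{0<..t}. left_count s \<omega> = k} = (if k < N t \<omega> then 1 else 0)"
proof -
  let ?\<mu> = "interval_measure (\<lambda>t. real (N t \<omega>))"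
  obtain b where b: "0 \<le> b" "{s\<in>{0<..t}. left_count s \<omega> \<le> k} = {0<..b}" "N b \<omega> = min (N t \<omega>) (Suc k)"
    using left_count_le_set[OF assms] .
  \<comment> \<open>For \<open>k = 0\<close> the set is empty and is represented as
    \<open>{0<..0}\<close>; otherwise \<open>< Suc j\<close> means \<open>\<le> j\<close>.\<close>
  obtain a where a: "0 \<le> a" "{s\<in>{0<..t}. left_count s \<omega> < k} = {0<..a}" "N a \<omega> = min (N t \<omega>) k"
  proof (cases k)
    case 0
    then show ?thesis using N_past[OF \<omega>, of 0] by (intro that[of 0]) auto
  next
    case (Suc j)
    then show ?thesis using left_count_le_set[OF assms, of j] that by (auto simp: less_Suc_eq_le)
  qed
  have *: "{s\<in>{0<..t}. left_count s \<omega> = k} = {0<..b} - {0<..a}"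
    unfolding a(2)[symmetric] b(2)[symmetric] by auto
  show "{s\<in>{0<..t}. left_count s \<omega> = k} \<in> sets borel"
    unfolding * by simp
  have "{0<..a} \<subseteq> {0<..b}"
    unfolding a(2)[symmetric] b(2)[symmetric] by auto
  then have "emeasure ?\<mu> ({0<..b} - {0<..a}) = emeasure ?\<mu> {0<..b} - emeasure ?\<mu> {0<..a}"
    using a(1) by (intro emeasure_Diff) (auto simp: emeasure_path_Ioc)
  also have "\<dots> = (if k < N t \<omega> then 1 else 0)"
    using a b N_past[OF \<omega>, of 0]
    by (auto simp: emeasure_path_Ioc ennreal_minus min_def)
  finally show "emeasure ?\<mu> {s\<in>{0<..t}. left_count s \<omega> = k} = (if k < N t \<omega> then 1 else 0)"
    unfolding * .
qed

text \<open>The interval is split by the value of the left limit; the jump from \<open>k\<close> to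
  \<open>Suc k\<close> contributes \<open>w k\<close> once if it has occurred by time
  \<open>t\<close>. This is the pathwise half of Dynkin's formula.\<close>

lemma nn_integral_path:
  fixes w :: "nat \<Rightarrow> ennreal"
  assumes "0 \<le> t"
  shows "(\<integral>\<^sup>+ s\<in>{0<..t}. w (left_count s \<omega>) \<partial>interval_measure (\<lambda>t. real (N t \<omega>))) = (\<Sum>k<N t \<omega>. w k)"
proof -
  let ?\<mu> = "interval_measure (\<lambda>t. real (N t \<omega>))"
  let ?A = "\<lambda>k. {s\<in>{0<..t}. left_count s \<omega> = k}"
  have "w (left_count s \<omega>) * indicator {0<..t} s = (\<Sum>k. w k * indicator (?A k) s)" for s
    by (subst suminf_finite[of "{left_count s \<omega>}"]) (auto simp: indicator_def)
  then have "(\<integral>\<^sup>+ s\<in>{0<..t}. w (left_count s \<omega>) \<partial>?\<mu>) = (\<integral>\<^sup>+ s. (\<Sum>k. w k * indicator (?A k) s) \<partial>?\<mu>)"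
    by simp
  also have "\<dots> = (\<Sum>k. \<integral>\<^sup>+ s. w k * indicator (?A k) s \<partial>?\<mu>)"
    using emeasure_left_count_eq(1)[OF assms] by (intro nn_integral_suminf) auto
  also have "\<dots> = (\<Sum>k. w k * (if k < N t \<omega> then 1 else 0))"
    using emeasure_left_count_eq[OF assms] by (subst nn_integral_cmult_indicator) auto
  also have "\<dots> = (\<Sum>k<N t \<omega>. w k)"
    by (subst suminf_finite[of "{..<N t \<omega>}"]) auto
  finally show ?thesis .
qed

end

section \<open>Joint measurability and predictability of the left limit\<close>

lemma less_left_count_set:
  "{(s, \<omega>) \<in> S \<times> space M. k < left_count s \<omega>} =
     (\<Union>q\<in>\<rat> \<inter> {0..}. (S \<inter> {q<..}) \<times> {\<omega> \<in> space M. k < N q \<omega>})"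
  by (auto simp: less_left_count_iff)

lemma N_measurable'[measurable]: "N t \<in> M \<rightarrow>\<^sub>M count_space UNIV"
  by (rule N_measurable)

text \<open>The product version serves the exchange of integrals; the predictable version further
  below serves to test the intensity.\<close>

lemma measurable_left_count: "(\<lambda>(s, \<omega>). left_count s \<omega>) \<in> borel \<Otimes>\<^sub>M M \<rightarrow>\<^sub>M count_space UNIV"
proof (rule measurable_nat_greaterI)
  fix k
  have "{x \<in> space (borel \<Otimes>\<^sub>M M). k < (case x of (s, \<omega>) \<Rightarrow> left_count s \<omega>)} =
      {(s, \<omega>) \<in> UNIV \<times> space M. k < left_count s \<omega>}"
    by (auto simp: space_pair_measure)
  also have "\<dots> \<in> sets (borel \<Otimes>\<^sub>M M)"
    unfolding less_left_count_set
    by (intro sets.countable_UN'' countable_Int1 countable_rat pair_measureI) auto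
  finally show "{x \<in> space (borel \<Otimes>\<^sub>M M). k < (case x of (s, \<omega>) \<Rightarrow> left_count s \<omega>)} \<in> sets (borel \<Otimes>\<^sub>M M)" .
qed

abbreviation (input) "\<P> \<equiv> predictable_sigma M (natural_filtration M N)"

lemma space_natural_filtration: "space (natural_filtration M N t) = space M"
  unfolding natural_filtration_def by (rule space_measure_of) auto

lemma less_N_in_natural_filtration: "{\<omega> \<in> space M. k < N t \<omega>} \<in> sets (natural_filtration M N t)"
proof -
  have "{\<omega> \<in> space M. k < N t \<omega>} = N t -` {k<..} \<inter> space M"
    by auto
  then show ?thesis
    unfolding natural_filtration_def by (subst sets_measure_of) (auto intro!: sigma_sets.Basic)
qed

lemma predictable_generators:
  "{{r<..s} \<times> A | r s A. 0 \<le> r \<and> r \<le> s \<and> A \<in> sets (natural_filtration M N r)} \<subseteq> Pow ({0<..} \<times> space M)"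
  using sets.sets_into_space space_natural_filtration by fastforce

lemma space_predictable: "space \<P> = {0<..} \<times> space M"
  unfolding predictable_sigma_def by (rule space_measure_of[OF predictable_generators])

lemma predictable_rect:
  "0 \<le> r \<Longrightarrow> r \<le> s \<Longrightarrow> A \<in> sets (natural_filtration M N r) \<Longrightarrow> {r<..s} \<times> A \<in> sets \<P>"
  unfolding predictable_sigma_def
  by (subst sets_measure_of[OF predictable_generators]) (auto intro!: sigma_sets.Basic)

text \<open>The event \<open>k < N q \<omega>\<close> is known at time \<open>q\<close>, and the
  half-line after \<open>q\<close> is exhausted by the intervals \<open>{q<..q + real n}\<close>, so
  superlevel sets are countable unions of generators.\<close>

lemma predictable_left_count: "(\<lambda>(s, \<omega>). left_count s \<omega>) \<in> \<P> \<rightarrow>\<^sub>M count_space UNIV"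
proof (rule measurable_nat_greaterI)
  fix k
  have "{x \<in> space \<P>. k < (case x of (s, \<omega>) \<Rightarrow> left_count s \<omega>)} =
      {(s, \<omega>) \<in> {0<..} \<times> space M. k < left_count s \<omega>}"
    by (auto simp: space_predictable)
  also have "\<dots> = (\<Union>q\<in>\<rat> \<inter> {0..}. \<Union>n::nat. {q<..q + real n} \<times> {\<omega> \<in> space M. k < N q \<omega>})"
  proof -
    have "{0<..} \<inter> {q<..} = (\<Union>n::nat. {q<..q + real n})" if "0 \<le> q" for q :: real
    proof -
      have "\<exists>n::nat. x \<le> q + real n" for x
        using real_arch_simple[of "x - q"] by (auto simp: algebra_simps)
      then show ?thesis using that by auto
    qed
    then show ?thesis
      unfolding less_left_count_set by (intro SUP_cong) auto
  qed
  also have "\<dots> \<in> sets \<P>"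
    by (intro sets.countable_UN'' countable_Int1 countable_rat predictable_rect
        less_N_in_natural_filtration) auto
  finally show "{x \<in> space \<P>. k < (case x of (s, \<omega>) \<Rightarrow> left_count s \<omega>)} \<in> sets \<P>" .
qed

lemma predictable_weight:
  fixes w :: "nat \<Rightarrow> ennreal"
  assumes "0 \<le> t"
  shows "(\<lambda>(s, \<omega>). w (left_count s \<omega>) * indicator {0<..t} s) \<in> borel_measurable \<P>"
proof -
  have "(\<lambda>x. w (case x of (s, \<omega>) \<Rightarrow> left_count s \<omega>)) \<in> borel_measurable \<P>"
    by (rule measurable_compose[OF predictable_left_count]) simp
  moreover have "indicator ({0<..t} \<times> space M) \<in> borel_measurable \<P>"
    using predictable_rect[of 0 t "space M"] assms
      sets.top[of "natural_filtration M N 0"] by (simp add: space_natural_filtration)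
  ultimately have "(\<lambda>x. w (case x of (s, \<omega>) \<Rightarrow> left_count s \<omega>) * indicator ({0<..t} \<times> space M) x)
      \<in> borel_measurable \<P>"
    by measurable
  then show ?thesis
    by (rule measurable_cong[THEN iffD1, rotated])
       (auto simp: space_predictable indicator_def)
qed

end

section \<open>Uniqueness for the linear equation \<open>f' = a + c * f / (t + 1)\<close> in
  integrated form\<close>

lemma linear_integral_equation_unique:
  fixes f g a :: "real \<Rightarrow> real" and c :: nat
  assumes f_nonneg: "\<And>t. 0 \<le> t \<Longrightarrow> 0 \<le> f t" and a_nonneg: "\<And>t. 0 \<le> t \<Longrightarrow> 0 \<le> a t"
    and f_cont: "\<And>T. continuous_on {0..T} f" and a_cont: "\<And>T. continuous_on {0..T} a"
    and f_eq: "\<And>t. 0 \<le> t \<Longrightarrow>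
      ennreal (f t) = (\<integral>\<^sup>+s\<in>{0<..t}. ennreal (a s + real c * f s / (s + 1)) \<partial>lborel)"
    and g_deriv: "\<And>t. 0 \<le> t \<Longrightarrow> (g has_real_derivative a t + real c * g t / (t + 1)) (at t)"
    and g_0: "g 0 = 0"
    and "0 \<le> t"
  shows "f t = g t"
proof -
  define G where "G s = a s + real c * f s / (s + 1)" for s
  have G_cont: "continuous_on {0..T} G" for T
    unfolding G_def by (intro continuous_intros f_cont a_cont) auto
  have G_nonneg: "0 \<le> G s" if "0 \<le> s" for s
    using f_nonneg[OF that] a_nonneg[OF that] that by (simp add: G_def)
  have f_integral: "f s = integral {0..s} G" if "0 \<le> s" for s
  proof -
    have "ennreal (f s) = (\<integral>\<^sup>+x. ennreal (G x) * indicator {0<..s} x \<partial>lborel)"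
      using f_eq[OF that] by (simp add: G_def)
    \<comment> \<open>The half-open and the closed interval differ by the null set
      \<open>{0}\<close>.\<close>
    also have "\<dots> = (\<integral>\<^sup>+x. ennreal (indicator {0..s} x * G x) \<partial>lborel)"
      using AE_lborel_singleton[of 0] by (intro nn_integral_cong_AE) (auto simp: indicator_def)
    also have "\<dots> = ennreal (integral {0..s} G)"
      by (rule nn_integral_has_integral_lebesgue)
         (auto intro!: G_nonneg integrable_integral integrable_continuous_interval G_cont)
    finally have "ennreal (f s) = ennreal (integral {0..s} G)" .
    moreover have "0 \<le> integral {0..s} G"
      by (intro integral_nonneg integrable_continuous_interval G_cont) (simp add: G_nonneg)
    ultimately show ?thesis
      using f_nonneg[OF that] by simp
  qed
  \<comment> \<open>Continuity of \<open>f\<close> makes \<open>G\<close> continuous, so the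
    fundamental theorem of calculus applies.\<close>
  have f_deriv: "(f has_real_derivative G s) (at s within {0..t})" if "s \<in> {0..t}" for s
    by (rule has_field_derivative_transform_within[OF integral_has_real_derivative[OF G_cont that], of 1])
       (use that f_integral in auto)
  \<comment> \<open>The difference \<open>f - g\<close> solves the homogeneous equation, whose
    solutions are multiples of \<open>(s + 1) ^ c\<close>; hence the quotient is constant, and it
    vanishes at 0.\<close>
  have "((\<lambda>s. (f s - g s) / (s + 1) ^ c) has_real_derivative 0) (at s within {0..t})"
    if "s \<in> {0..t}" for s
  proof -
    \<comment> \<open>The case split handles \<open>c = 0\<close>, where \<open>c - 1\<close> is
      truncated but both sides vanish.\<close>
    have "real c * (s + 1) ^ (c - 1) = real c * (s + 1) ^ c / (s + 1)"
      using that by (cases c) auto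
    then have P: "((\<lambda>s. (s + 1) ^ c) has_real_derivative real c * (s + 1) ^ c / (s + 1)) (at s within {0..t})"
      by (auto intro!: derivative_eq_intros)
    have "((\<lambda>s. f s - g s) has_real_derivative G s - (a s + real c * g s / (s + 1))) (at s within {0..t})"
      using that by (intro DERIV_diff f_deriv DERIV_subset[OF g_deriv]) auto
    also have "G s - (a s + real c * g s / (s + 1)) = real c * (f s - g s) / (s + 1)"
      by (simp add: G_def diff_divide_distrib right_diff_distrib)
    finally have "((\<lambda>s. f s - g s) has_real_derivative real c * (f s - g s) / (s + 1)) (at s within {0..t})" .
    from DERIV_divide[OF this P] show ?thesis
      using that by (simp add: mult_ac)
  qed
  then obtain d where "\<And>s. s \<in> {0..t} \<Longrightarrow> (f s - g s) / (s + 1) ^ c = d"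
    using has_field_derivative_zero_constant[of "{0..t}" "\<lambda>s. (f s - g s) / (s + 1) ^ c"] by auto
  from this[of 0] this[of t] have "(f t - g t) / (t + 1) ^ c = 0"
    using \<open>0 \<le> t\<close> f_integral[of 0] g_0 by simp
  then show ?thesis
    using \<open>0 \<le> t\<close> by simp
qed

section \<open>Dynkin's formula for the self-exciting process\<close>

locale self_exciting_process = simple_point_process M N
  for M :: "'a measure" and N :: "real \<Rightarrow> 'a \<Rightarrow> nat" +
  fixes \<beta> :: real
  assumes \<beta>_pos: "0 < \<beta>"
    and intensity: "has_intensity M (natural_filtration M N) N
           (\<lambda>t \<omega>. \<beta> + left_lim (\<lambda>s. real (N s \<omega>)) t / (t + 1))"
begin

text \<open>The test function is encoded by its increments \<open>w\<close>, which is what a unit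
  jump sees. Extended nonnegative values allow use before integrability is known.\<close>

definition moment :: "(nat \<Rightarrow> ennreal) \<Rightarrow> real \<Rightarrow> ennreal" where
  "moment w t = (\<integral>\<^sup>+\<omega>. (\<Sum>k<N t \<omega>. w k) \<partial>M)"

definition left_moment :: "(nat \<Rightarrow> ennreal) \<Rightarrow> real \<Rightarrow> ennreal" where
  "left_moment w t = (\<integral>\<^sup>+\<omega>. (\<Sum>k<left_count t \<omega>. w k) \<partial>M)"

text \<open>The expected generator of the process applied to the test function with increments
  \<open>w\<close>: jump rate times increment, both at the left limit.\<close>

definition drift :: "(nat \<Rightarrow> ennreal) \<Rightarrow> real \<Rightarrow> ennreal" where
  "drift w s = (\<integral>\<^sup>+\<omega>. w (left_count s \<omega>) * ennreal (\<beta> + real (left_count s \<omega>) / (s + 1)) \<partial>M)"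

lemma measurable_left_count_section[measurable]: "left_count s \<in> M \<rightarrow>\<^sub>M count_space UNIV"
  using measurable_compose[OF measurable_Pair1'[of s borel M] measurable_left_count] by simp

lemma measurable_drift_integrand:
  "(\<lambda>(s, \<omega>). w (left_count s \<omega>) * ennreal (\<beta> + real (left_count s \<omega>) / (s + 1)))
     \<in> borel_measurable (borel \<Otimes>\<^sub>M M)" for w :: "nat \<Rightarrow> ennreal"
proof -
  have [measurable]: "(\<lambda>x. left_count (fst x) (snd x)) \<in> borel \<Otimes>\<^sub>M M \<rightarrow>\<^sub>M count_space UNIV"
    using measurable_left_count by (simp add: case_prod_unfold)
  have [measurable]: "(\<lambda>x. w (left_count (fst x) (snd x))) \<in> borel_measurable (borel \<Otimes>\<^sub>M M)"
    by (rule measurable_compose[of _ _ "count_space UNIV"]) auto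
  show ?thesis
    unfolding case_prod_unfold by measurable
qed

lemma measurable_drift[measurable]: "drift w \<in> borel_measurable borel"
proof -
  have "(\<lambda>s. \<integral>\<^sup>+\<omega>. (\<lambda>(s, \<omega>). w (left_count s \<omega>) * ennreal (\<beta> + real (left_count s \<omega>) / (s + 1))) (s, \<omega>) \<partial>M)
      \<in> borel_measurable borel"
    by (rule borel_measurable_nn_integral_fst[OF measurable_drift_integrand])
  then show ?thesis
    unfolding drift_def[abs_def] by simp
qed

text \<open>Dynkin's formula. \<open>nn_integral_path\<close> evaluates the jump side of the
  intensity identity, and Tonelli's theorem exchanges the integrals on the other side; nonnegativity
  makes integrability unnecessary.\<close>

lemma moment_eq_integral_drift:
  assumes "0 \<le> t"
  shows "moment w t = (\<integral>\<^sup>+s\<in>{0<..t}. drift w s \<partial>lborel)"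
proof -
  let ?C = "\<lambda>s \<omega>. w (left_count s \<omega>) * indicator {0<..t} s"
  let ?l = "\<lambda>s \<omega>. ennreal (\<beta> + real (left_count s \<omega>) / (s + 1))"
  interpret MS: pair_sigma_finite lborel M
    by (simp add: pair_sigma_finite_def lborel.sigma_finite_measure_axioms sigma_finite_measure_axioms)
  have "moment w t = (\<integral>\<^sup>+\<omega>. (\<integral>\<^sup>+s\<in>{0<..}. ?C s \<omega> \<partial>interval_measure (\<lambda>t. real (N t \<omega>))) \<partial>M)"
    unfolding moment_def
    by (intro nn_integral_cong, subst nn_integral_path[symmetric])
       (auto simp: assms indicator_def intro!: nn_integral_cong)
  also have "\<dots> = (\<integral>\<^sup>+\<omega>. (\<integral>\<^sup>+s\<in>{0<..}. ?C s \<omega> *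
      ennreal (\<beta> + left_lim (\<lambda>s. real (N s \<omega>)) s / (s + 1)) \<partial>lborel) \<partial>M)"
    using intensity predictable_weight[OF assms, of w] unfolding has_intensity_def by blast
  also have "\<dots> = (\<integral>\<^sup>+\<omega>. (\<integral>\<^sup>+s. w (left_count s \<omega>) * ?l s \<omega> * indicator {0<..t} s \<partial>lborel) \<partial>M)"
    by (intro nn_integral_cong) (auto simp: left_lim_eq_left_count indicator_def)
  also have "\<dots> = (\<integral>\<^sup>+s. (\<integral>\<^sup>+\<omega>. w (left_count s \<omega>) * ?l s \<omega> * indicator {0<..t} s \<partial>M) \<partial>lborel)"
  proof (rule MS.Fubini')
    have "(\<lambda>x. (\<lambda>(s, \<omega>). w (left_count s \<omega>) * ?l s \<omega>) x * indicator {0<..t} (fst x))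
        \<in> borel_measurable (borel \<Otimes>\<^sub>M M)"
      using measurable_drift_integrand[of w] by measurable
    also have "borel_measurable (borel \<Otimes>\<^sub>M M) = borel_measurable (lborel \<Otimes>\<^sub>M M)"
      by (intro measurable_cong_sets sets_pair_measure_cong) auto
    finally show "(\<lambda>(s, \<omega>). w (left_count s \<omega>) * ?l s \<omega> * indicator {0<..t} s)
        \<in> borel_measurable (lborel \<Otimes>\<^sub>M M)"
      by (simp add: case_prod_unfold)
  qed
  also have "\<dots> = (\<integral>\<^sup>+s\<in>{0<..t}. drift w s \<partial>lborel)"
    unfolding drift_def by (intro nn_integral_cong nn_integral_multc) measurable
  finally show ?thesis .
qed

lemma moment_increment:
  assumes "0 \<le> a" "a \<le> t"
  shows "moment w t = moment w a + (\<integral>\<^sup>+s\<in>{a<..t}. drift w s \<partial>lborel)"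
proof -
  have "{0<..t} = {0<..a} \<union> {a<..t}" using assms by auto
  then have "(\<integral>\<^sup>+s\<in>{0<..t}. drift w s \<partial>lborel) = (\<integral>\<^sup>+s\<in>{0<..a} \<union> {a<..t}. drift w s \<partial>lborel)"
    by simp
  also have "\<dots> = (\<integral>\<^sup>+s\<in>{0<..a}. drift w s \<partial>lborel) + (\<integral>\<^sup>+s\<in>{a<..t}. drift w s \<partial>lborel)"
    by (rule nn_integral_disjoint_pair) auto
  finally show ?thesis
    using assms by (simp add: moment_eq_integral_drift)
qed

section \<open>Monotonicity in time, finiteness and continuity of the moments\<close>

lemma moment_le_left_moment: "r < s \<Longrightarrow> moment w r \<le> left_moment w s"
  unfolding moment_def left_moment_def
  by (intro nn_integral_mono sum_mono2) (auto dest: N_le_left_count)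

lemma left_moment_le_moment: "s \<le> t \<Longrightarrow> left_moment w s \<le> moment w t"
  unfolding moment_def left_moment_def
  by (intro nn_integral_mono sum_mono2) (auto intro: order_trans[OF left_count_le N_le])

lemma moment_mono: "s \<le> t \<Longrightarrow> moment w s \<le> moment w t"
  unfolding moment_def by (intro nn_integral_mono sum_mono2) (auto intro: N_le)

lemma moment_0: "moment w 0 = 0"
  using moment_eq_integral_drift[of 0 w] by simp

text \<open>Since \<open>s + 1\<close> is at least 1, the jump rate is at most
  \<open>\<beta> + real k\<close> at left limit \<open>k\<close>. The growth condition bounds the
  drift by the test function itself, and monotonicity in time makes that bound uniform on
  \<open>{a<..t}\<close>.\<close>

lemma moment_increment_le:
  assumes growth: "\<And>k. w k * ennreal (\<beta> + real k) \<le> A + B * (\<Sum>j<k. w j)"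
    and "0 \<le> a" "a \<le> t"
  shows "moment w t \<le> moment w a + ennreal (t - a) * (A + B * moment w t)"
proof -
  have drift_le: "drift w s \<le> A + B * moment w t" if "0 < s" "s \<le> t" for s
  proof -
    have "drift w s \<le> (\<integral>\<^sup>+\<omega>. A + B * (\<Sum>k<left_count s \<omega>. w k) \<partial>M)"
      unfolding drift_def
    proof (rule nn_integral_mono)
      fix \<omega>
      let ?k = "left_count s \<omega>"
      have "real ?k / (s + 1) \<le> real ?k"
        using \<open>0 < s\<close> by (simp add: divide_le_eq mult_left_le field_simps)
      then have "w ?k * ennreal (\<beta> + real ?k / (s + 1)) \<le> w ?k * ennreal (\<beta> + real ?k)"
        by (intro mult_left_mono ennreal_leI) auto
      also note growth
      finally show "w ?k * ennreal (\<beta> + real ?k / (s + 1)) \<le> A + B * (\<Sum>k<?k. w k)" .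
    qed
    also have "\<dots> = A + B * left_moment w s"
      unfolding left_moment_def by (simp add: nn_integral_add nn_integral_cmult emeasure_space_1)
    also have "\<dots> \<le> A + B * moment w t"
      by (intro add_left_mono mult_left_mono left_moment_le_moment that) auto
    finally show ?thesis .
  qed
  have "(\<integral>\<^sup>+s\<in>{a<..t}. drift w s \<partial>lborel) \<le> (\<integral>\<^sup>+s\<in>{a<..t}. (A + B * moment w t) \<partial>lborel)"
    using \<open>0 \<le> a\<close> by (intro nn_integral_mono) (auto simp: indicator_def intro!: drift_le)
  also have "\<dots> = ennreal (t - a) * (A + B * moment w t)"
    using \<open>a \<le> t\<close> by (subst nn_integral_cmult_indicator) (auto simp: mult.commute)
  finally show ?thesis
    unfolding moment_increment[OF \<open>0 \<le> a\<close> \<open>a \<le> t\<close>] by (rule add_left_mono)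
qed

text \<open>Summation by tail probabilities: truncating the weights amounts to taking a partial sum
  of this series.\<close>

lemma moment_eq_suminf: "moment w t = (\<Sum>k. w k * emeasure M {\<omega> \<in> space M. k < N t \<omega>})"
proof -
  have "moment w t = (\<integral>\<^sup>+\<omega>. (\<Sum>k. w k * indicator {\<omega> \<in> space M. k < N t \<omega>} \<omega>) \<partial>M)"
    unfolding moment_def
  proof (rule nn_integral_cong)
    fix \<omega> assume "\<omega> \<in> space M"
    then show "(\<Sum>k<N t \<omega>. w k) = (\<Sum>k. w k * indicator {\<omega> \<in> space M. k < N t \<omega>} \<omega>)"
      by (subst suminf_finite[of "{..<N t \<omega>}"]) auto
  qed
  also have "\<dots> = (\<Sum>k. w k * emeasure M {\<omega> \<in> space M. k < N t \<omega>})"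
    by (subst nn_integral_suminf) (auto simp: nn_integral_cmult_indicator)
  finally show ?thesis .
qed

text \<open>Without a priori integrability the bound \<open>f (t + h) \<le> f t + h * (A + B * f (t + h))\<close> is void
  when \<open>f (t + h) = \<infinity>\<close>. It is therefore applied to the weights truncated at \<open>n\<close>, with \<open>h * B = 1/2\<close>,
  and yields bounds that do not depend on \<open>n\<close>.\<close>
lemma moment_finite:
  fixes v :: "nat \<Rightarrow> real" and A B :: real
  assumes "0 \<le> A" "0 < B"
    and growth: "\<And>k. ennreal (v k) * ennreal (\<beta> + real k) \<le> ennreal A + ennreal B * (\<Sum>j<k. ennreal (v j))"
  shows "moment (\<lambda>k. ennreal (v k)) t < \<infinity>"
proof -
  define w where "w n k = (if k < n then ennreal (v k) else 0)" for n k :: nat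
  define p where "p t k = emeasure M {\<omega> \<in> space M. k < N t \<omega>}" for t k
  define h where "h = 1 / (2 * B)"
  have h: "0 < h" "h * B = 1 / 2" using \<open>0 < B\<close> by (auto simp: h_def)
  have w_moment: "moment (w n) t = (\<Sum>k<n. ennreal (v k) * p t k)" for n t
    unfolding moment_eq_suminf p_def[symmetric]
    by (subst suminf_finite[of "{..<n}"]) (auto simp: w_def)
  \<comment> \<open>Finitely many terms remain, each a finite weight times a probability.\<close>
  have w_finite: "moment (w n) t < \<infinity>" for n t
    unfolding w_moment p_def by (simp add: less_top[symmetric] ennreal_mult_eq_top_iff)
  \<comment> \<open>Truncation preserves the growth condition: below \<open>n\<close> nothing
    changes, and from \<open>n\<close> on the left side is 0.\<close>
  have w_growth: "w n k * ennreal (\<beta> + real k) \<le> ennreal A + ennreal B * (\<Sum>j<k. w n j)" for n k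
  proof (cases "k < n")
    case True
    then have "(\<Sum>j<k. w n j) = (\<Sum>j<k. ennreal (v j))"
      by (intro sum.cong) (auto simp: w_def)
    then show ?thesis
      using growth[of k] True by (simp add: w_def)
  qed (simp add: w_def)
  have bounded: "\<exists>c\<ge>0. \<forall>n. moment (w n) (real j * h) \<le> ennreal c" for j
  proof (induction j)
    case 0
    then show ?case by (auto simp: moment_0)
  next
    case (Suc j)
    then obtain c where c: "0 \<le> c" "\<And>n. moment (w n) (real j * h) \<le> ennreal c" by auto
    \<comment> \<open>The constant comes from solving \<open>x \<le> c + h * A + x / 2\<close> for
      the finite value \<open>x\<close>.\<close>
    have "moment (w n) (real (Suc j) * h) \<le> ennreal (2 * c + 2 * h * A)" for n
    proof -
      obtain x where x: "moment (w n) (real (Suc j) * h) = ennreal x" "0 \<le> x"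
        using w_finite[of n "real (Suc j) * h"] by (cases "moment (w n) (real (Suc j) * h)") auto
      have "ennreal x \<le> moment (w n) (real j * h) + ennreal (real (Suc j) * h - real j * h) * (ennreal A + ennreal B * ennreal x)"
        unfolding x(1)[symmetric] by (intro moment_increment_le w_growth) (use h in auto)
      also have "\<dots> \<le> ennreal c + ennreal h * (ennreal A + ennreal B * ennreal x)"
        using c(2) by (intro add_mono) (auto simp: algebra_simps)
      also have "\<dots> = ennreal (c + h * (A + B * x))"
        using x(2) c(1) h \<open>0 \<le> A\<close> \<open>0 < B\<close> by (simp add: ennreal_mult ennreal_plus)
      finally have "x \<le> c + h * (A + B * x)"
        using x(2) c(1) h \<open>0 \<le> A\<close> \<open>0 < B\<close> by (subst (asm) ennreal_le_iff) auto
      also have "h * (A + B * x) = h * A + x / 2"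
        using h(2) by (simp add: algebra_simps)
      finally show ?thesis
        unfolding x(1) by (intro ennreal_leI) simp
    qed
    moreover have "0 \<le> 2 * c + 2 * h * A" using c h \<open>0 \<le> A\<close> by simp
    ultimately show ?case by blast
  qed
  obtain j :: nat where "t / h \<le> real j" using real_arch_simple by blast
  then have j: "t \<le> real j * h" using h(1) by (simp add: divide_le_eq)
  obtain c where c: "\<And>n. moment (w n) (real j * h) \<le> ennreal c" using bounded[of j] by auto
  have "moment (\<lambda>k. ennreal (v k)) t \<le> moment (\<lambda>k. ennreal (v k)) (real j * h)"
    by (rule moment_mono[OF j])
  also have "\<dots> = (SUP n. \<Sum>k<n. ennreal (v k) * p (real j * h) k)"
    unfolding moment_eq_suminf p_def[symmetric] by (rule suminf_eq_SUP)
  also have "\<dots> \<le> ennreal c"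
    using c by (intro SUP_least) (simp add: w_moment)
  finally show ?thesis
    by (simp add: le_less_trans)
qed

text \<open>Once the moments are finite, their growth rate on \<open>{0..T}\<close> is at most the
  constant \<open>A + B * f T\<close>, which gives Lipschitz continuity. The left moment at
  \<open>s\<close> lies between the moments at \<open>r < s\<close> and at \<open>s\<close>, so
  letting \<open>r\<close> approach \<open>s\<close> gives equality.\<close>

lemma
  fixes v :: "nat \<Rightarrow> real" and A B :: real
  assumes "0 \<le> A" "0 < B"
    and growth: "\<And>k. ennreal (v k) * ennreal (\<beta> + real k) \<le> ennreal A + ennreal B * (\<Sum>j<k. ennreal (v j))"
  shows left_moment_eq: "0 < s \<Longrightarrow> left_moment (\<lambda>k. ennreal (v k)) s = moment (\<lambda>k. ennreal (v k)) s"
    and continuous_moment: "continuous_on {0..T} (\<lambda>t. enn2real (moment (\<lambda>k. ennreal (v k)) t))"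
proof -
  let ?w = "\<lambda>k. ennreal (v k)"
  define f where "f t = enn2real (moment ?w t)" for t
  have f: "moment ?w t = ennreal (f t)" "0 \<le> f t" for t
    using moment_finite[OF assms, of t] by (auto simp: f_def)
  have f_incr: "f t \<le> f a + (t - a) * (A + B * f T)" if "0 \<le> a" "a \<le> t" "t \<le> T" for a t T
  proof -
    have "ennreal (f t) \<le> ennreal (f a) + ennreal (t - a) * (ennreal A + ennreal B * ennreal (f t))"
      using moment_increment_le[OF growth that(1,2)] by (simp add: f)
    also have "\<dots> = ennreal (f a + (t - a) * (A + B * f t))"
      using that f(2) \<open>0 \<le> A\<close> \<open>0 < B\<close> by (simp add: ennreal_mult ennreal_plus)
    finally have "f t \<le> f a + (t - a) * (A + B * f t)"
      using that f(2) \<open>0 \<le> A\<close> \<open>0 < B\<close> by (subst (asm) ennreal_le_iff) auto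
    also have "f t \<le> f T"
      using moment_mono[OF that(3), of ?w] by (simp add: f)
    then have "f a + (t - a) * (A + B * f t) \<le> f a + (t - a) * (A + B * f T)"
      using that \<open>0 < B\<close> by (intro add_left_mono mult_left_mono) auto
    finally show ?thesis .
  qed
  show "left_moment ?w s = moment ?w s" if "0 < s"
  proof (rule antisym)
    show "left_moment ?w s \<le> moment ?w s"
      by (rule left_moment_le_moment) simp
    \<comment> \<open>The summand 1 keeps \<open>K\<close> positive, so that division by it is
      safe.\<close>
    define K where "K = A + B * f s + 1"
    have K: "0 < K" using f(2)[of s] \<open>0 \<le> A\<close> \<open>0 < B\<close> by (simp add: K_def add_nonneg_pos)
    show "moment ?w s \<le> left_moment ?w s"
    proof (rule ennreal_le_epsilon)
      fix e :: real assume "0 < e"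
      \<comment> \<open>Close enough to \<open>s\<close> that the increment costs at most
        \<open>e\<close>; the maximum keeps \<open>r\<close> nonnegative.\<close>
      define r where "r = max 0 (s - e / K)"
      have r: "0 \<le> r" "r < s" "(s - r) * K \<le> e"
        using \<open>0 < e\<close> K \<open>0 < s\<close> by (auto simp: r_def max_def field_simps)
      have "f s \<le> f r + (s - r) * (A + B * f s)"
        using r by (intro f_incr) auto
      also have "\<dots> \<le> f r + (s - r) * K"
        using r by (intro add_left_mono mult_left_mono) (auto simp: K_def)
      also have "\<dots> \<le> f r + e"
        using r by simp
      finally have "moment ?w s \<le> moment ?w r + ennreal e"
        using f(2) \<open>0 < e\<close> by (simp add: f(1) flip: ennreal_plus)
      also have "\<dots> \<le> left_moment ?w s + ennreal e"
        by (intro add_right_mono moment_le_left_moment r)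
      finally show "moment ?w s \<le> left_moment ?w s + ennreal e" .
    qed
  qed
  have "(A + B * f T)-lipschitz_on {0..T} f"
  proof (rule lipschitz_onI)
    fix x y assume xy: "x \<in> {0..T}" "y \<in> {0..T}"
    have *: "\<bar>f b - f a\<bar> \<le> (A + B * f T) * \<bar>b - a\<bar>" if "0 \<le> a" "a \<le> b" "b \<le> T" for a b
      using f_incr[OF that] moment_mono[OF that(2), of ?w] that by (simp add: f abs_if mult.commute)
    show "dist (f x) (f y) \<le> (A + B * f T) * dist x y"
      using *[of x y] *[of y x] xy by (cases "x \<le> y") (auto simp: dist_real_def abs_minus_commute)
  qed (use f(2) \<open>0 \<le> A\<close> \<open>0 < B\<close> in simp)
  then show "continuous_on {0..T} (\<lambda>t. enn2real (moment ?w t))"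
    unfolding f_def[symmetric] by (rule lipschitz_on_continuous_on)
qed

end

section \<open>Explicit first and second moments\<close>

context self_exciting_process
begin

lemma first_growth:
  "ennreal 1 * ennreal (\<beta> + real k) \<le> ennreal \<beta> + ennreal 1 * (\<Sum>j<k. ennreal 1)"
  using \<beta>_pos by (simp add: ennreal_plus ennreal_of_nat_eq_real_of_nat)

text \<open>Odd numbers are the increments of the squares, so these weights encode the second
  moment.\<close>

lemma sum_odd: "(\<Sum>j<k. ennreal (2 * real j + 1)) = ennreal ((real k)\<^sup>2)"
proof -
  have "(\<Sum>j<k. 2 * real j + 1) = (real k)\<^sup>2"
    by (induction k) (auto simp: power2_eq_square algebra_simps)
  then show ?thesis by (simp add: sum_ennreal del: ennreal_plus)
qed

text \<open>The left side expands to \<open>\<beta> + (2 * \<beta> + 1) * k + 2 * k^2\<close>, and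
  \<open>k \<le> k^2\<close> for natural \<open>k\<close> yields the constant
  \<open>2 * \<beta> + 3\<close>.\<close>

lemma second_growth:
  "ennreal (2 * real k + 1) * ennreal (\<beta> + real k) \<le>
     ennreal \<beta> + ennreal (2 * \<beta> + 3) * (\<Sum>j<k. ennreal (2 * real j + 1))"
proof -
  have "real k \<le> (real k)\<^sup>2"
    by (cases k) (auto simp: power2_eq_square field_simps)
  then have "(2 * \<beta> + 1) * real k \<le> (2 * \<beta> + 1) * (real k)\<^sup>2"
    using \<beta>_pos by (intro mult_left_mono) auto
  then have "(2 * real k + 1) * (\<beta> + real k) \<le> \<beta> + (2 * \<beta> + 3) * (real k)\<^sup>2"
    by (simp add: power2_eq_square algebra_simps)
  then show ?thesis
    using \<beta>_pos by (simp add: sum_odd ennreal_plus[symmetric] ennreal_mult[symmetric] del: ennreal_plus)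
qed

definition m1 :: "real \<Rightarrow> real" where "m1 t = enn2real (moment (\<lambda>k. ennreal 1) t)"

definition m2 :: "real \<Rightarrow> real" where "m2 t = enn2real (moment (\<lambda>k. ennreal (2 * real k + 1)) t)"

lemma m1_nonneg: "0 \<le> m1 t" and m2_nonneg: "0 \<le> m2 t"
  by (simp_all add: m1_def m2_def)

lemma moment1: "moment (\<lambda>k. ennreal 1) t = ennreal (m1 t)"
  using moment_finite[OF _ _ first_growth, of t] \<beta>_pos by (simp add: m1_def)

lemma moment2: "moment (\<lambda>k. ennreal (2 * real k + 1)) t = ennreal (m2 t)"
  using moment_finite[OF _ _ second_growth, of t] \<beta>_pos by (simp add: m2_def)

lemma nn_integral_N: "(\<integral>\<^sup>+\<omega>. ennreal (real (N t \<omega>)) \<partial>M) = ennreal (m1 t)"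
  unfolding moment1[symmetric] moment_def by (simp add: ennreal_of_nat_eq_real_of_nat)

lemma nn_integral_N2: "(\<integral>\<^sup>+\<omega>. ennreal ((real (N t \<omega>))\<^sup>2) \<partial>M) = ennreal (m2 t)"
  unfolding moment2[symmetric] moment_def sum_odd ..

lemma nn_integral_left_count:
  "0 < s \<Longrightarrow> (\<integral>\<^sup>+\<omega>. ennreal (real (left_count s \<omega>)) \<partial>M) = ennreal (m1 s)"
  unfolding moment1[symmetric]
  using left_moment_eq[OF _ _ first_growth, of s] \<beta>_pos
  by (simp add: left_moment_def ennreal_of_nat_eq_real_of_nat)

lemma nn_integral_left_count2:
  "0 < s \<Longrightarrow> (\<integral>\<^sup>+\<omega>. ennreal ((real (left_count s \<omega>))\<^sup>2) \<partial>M) = ennreal (m2 s)"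
  unfolding moment2[symmetric]
  using left_moment_eq[OF _ _ second_growth, of s] \<beta>_pos
  by (simp add: left_moment_def sum_odd del: ennreal_plus)

lemma drift1:
  assumes "0 < s"
  shows "drift (\<lambda>k. ennreal 1) s = ennreal (\<beta> + m1 s / (s + 1))"
proof -
  have "drift (\<lambda>k. ennreal 1) s =
      (\<integral>\<^sup>+\<omega>. ennreal \<beta> + ennreal (1 / (s + 1)) * ennreal (real (left_count s \<omega>)) \<partial>M)"
    unfolding drift_def
    using assms \<beta>_pos by (intro nn_integral_cong) (simp add: ennreal_plus ennreal_mult[symmetric])
  also have "\<dots> = ennreal \<beta> + ennreal (1 / (s + 1)) * ennreal (m1 s)"
    by (simp add: nn_integral_add nn_integral_cmult nn_integral_left_count assms emeasure_space_1)
  also have "\<dots> = ennreal (\<beta> + m1 s / (s + 1))"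
    using assms \<beta>_pos m1_nonneg[of s] by (simp add: ennreal_plus ennreal_mult[symmetric])
  finally show ?thesis .
qed

text \<open>Increment \<open>2 * k + 1\<close> times rate is a quadratic polynomial in the left
  limit, so no moment beyond the second appears. The coefficient \<open>2 / (s + 1)\<close> of the
  square later becomes \<open>c = 2\<close>.\<close>

lemma drift2:
  assumes "0 < s"
  shows "drift (\<lambda>k. ennreal (2 * real k + 1)) s =
    ennreal (\<beta> + (2 * \<beta> + 1 / (s + 1)) * m1 s + 2 * m2 s / (s + 1))"
proof -
  let ?b = "2 * \<beta> + 1 / (s + 1)" and ?c = "2 / (s + 1)"
  have "0 \<le> ?b" "0 \<le> ?c" using assms \<beta>_pos by auto
  have "drift (\<lambda>k. ennreal (2 * real k + 1)) s =
      (\<integral>\<^sup>+\<omega>. ennreal \<beta> + ennreal ?b * ennreal (real (left_count s \<omega>)) +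
        ennreal ?c * ennreal ((real (left_count s \<omega>))\<^sup>2) \<partial>M)"
    unfolding drift_def
  proof (rule nn_integral_cong)
    fix \<omega>
    let ?k = "real (left_count s \<omega>)"
    have "(2 * ?k + 1) * (\<beta> + ?k / (s + 1)) = \<beta> + ?b * ?k + ?c * ?k\<^sup>2"
      by (simp add: divide_inverse algebra_simps power2_eq_square)
    moreover have "ennreal (2 * ?k + 1) * ennreal (\<beta> + ?k / (s + 1)) = ennreal ((2 * ?k + 1) * (\<beta> + ?k / (s + 1)))"
      using assms \<beta>_pos by (intro ennreal_mult[symmetric]) auto
    moreover have "ennreal \<beta> + ennreal ?b * ennreal ?k + ennreal ?c * ennreal (?k\<^sup>2) = ennreal (\<beta> + ?b * ?k + ?c * ?k\<^sup>2)"
      using \<open>0 \<le> ?b\<close> \<open>0 \<le> ?c\<close> \<beta>_pos by (simp only: ennreal_plus ennreal_mult add_nonneg_nonneg mult_nonneg_nonneg less_imp_le of_nat_0_le_iff zero_le_power2)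
    ultimately show "ennreal (2 * ?k + 1) * ennreal (\<beta> + ?k / (s + 1)) =
        ennreal \<beta> + ennreal ?b * ennreal ?k + ennreal ?c * ennreal (?k\<^sup>2)"
      by simp
  qed
  also have "\<dots> = ennreal \<beta> + ennreal ?b * ennreal (m1 s) + ennreal ?c * ennreal (m2 s)"
    by (simp add: nn_integral_add nn_integral_cmult nn_integral_left_count nn_integral_left_count2 assms emeasure_space_1
        del: ennreal_plus)
  also have "\<dots> = ennreal (\<beta> + ?b * m1 s + ?c * m2 s)"
    using \<open>0 \<le> ?b\<close> \<open>0 \<le> ?c\<close> \<beta>_pos m1_nonneg[of s] m2_nonneg[of s]
    by (simp only: ennreal_plus ennreal_mult add_nonneg_nonneg mult_nonneg_nonneg less_imp_le)
  finally show ?thesis by simp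
qed

lemma has_real_derivative_mean:
  "0 \<le> t \<Longrightarrow> ((\<lambda>t. \<beta> * (t + 1) * ln (t + 1)) has_real_derivative \<beta> * ln (t + 1) + \<beta>) (at t)"
  by (auto intro!: derivative_eq_intros)

text \<open>Dynkin's formula with \<open>drift1\<close> is the linear integral equation with
  \<open>c = 1\<close> and constant inhomogeneity \<open>\<beta>\<close>.\<close>

lemma m1_eq:
  assumes "0 \<le> t"
  shows "m1 t = \<beta> * (t + 1) * ln (t + 1)"
proof (rule linear_integral_equation_unique[where f = m1 and g = "\<lambda>t. \<beta> * (t + 1) * ln (t + 1)"
      and a = "\<lambda>_. \<beta>" and c = 1])
  show "continuous_on {0..T} m1" for T
    unfolding m1_def[abs_def] by (rule continuous_moment[OF _ _ first_growth]) (use \<beta>_pos in auto)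
  show "ennreal (m1 t) = (\<integral>\<^sup>+s\<in>{0<..t}. ennreal (\<beta> + real 1 * m1 s / (s + 1)) \<partial>lborel)" if "0 \<le> t" for t
    unfolding moment1[symmetric] moment_eq_integral_drift[OF that]
    by (intro nn_integral_cong) (auto simp: indicator_def drift1[unfolded ennreal_1])
  show "((\<lambda>t. \<beta> * (t + 1) * ln (t + 1)) has_real_derivative
      \<beta> + real 1 * (\<beta> * (t + 1) * ln (t + 1)) / (t + 1)) (at t)" if "0 \<le> t" for t
    using has_real_derivative_mean[OF that] that by (simp add: add.commute)
qed (use assms \<beta>_pos m1_nonneg in auto)

text \<open>With \<open>m1\<close> explicit, the equation is linear in \<open>m2\<close> alone, with
  \<open>c = 2\<close>. The candidate solution is the claimed variance plus the squared
  mean.\<close>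

lemma m2_eq:
  assumes "0 \<le> t"
  shows "m2 t = - \<beta> * (t + 1) * ln (t + 1) + 2 * \<beta> * t * (t + 1) + (\<beta> * (t + 1) * ln (t + 1))\<^sup>2"
proof (rule linear_integral_equation_unique[where f = m2 and c = 2
      and g = "\<lambda>t. - \<beta> * (t + 1) * ln (t + 1) + 2 * \<beta> * t * (t + 1) + (\<beta> * (t + 1) * ln (t + 1))\<^sup>2"
      and a = "\<lambda>s. \<beta> + (2 * \<beta> + 1 / (s + 1)) * (\<beta> * (s + 1) * ln (s + 1))"])
  show "continuous_on {0..T} m2" for T
    unfolding m2_def[abs_def] by (rule continuous_moment[OF _ _ second_growth]) (use \<beta>_pos in auto)
  show "ennreal (m2 t) = (\<integral>\<^sup>+s\<in>{0<..t}. ennreal (\<beta> + (2 * \<beta> + 1 / (s + 1)) * (\<beta> * (s + 1) * ln (s + 1)) +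
      real 2 * m2 s / (s + 1)) \<partial>lborel)" if "0 \<le> t" for t
    unfolding moment2[symmetric] moment_eq_integral_drift[OF that]
    by (intro nn_integral_cong) (auto simp: indicator_def drift2 m1_eq simp del: ennreal_plus)
  show "((\<lambda>t. - \<beta> * (t + 1) * ln (t + 1) + 2 * \<beta> * t * (t + 1) + (\<beta> * (t + 1) * ln (t + 1))\<^sup>2) has_real_derivative
      \<beta> + (2 * \<beta> + 1 / (t + 1)) * (\<beta> * (t + 1) * ln (t + 1)) +
      real 2 * (- \<beta> * (t + 1) * ln (t + 1) + 2 * \<beta> * t * (t + 1) + (\<beta> * (t + 1) * ln (t + 1))\<^sup>2) / (t + 1)) (at t)"
    if "0 \<le> t" for t
  proof -
    define L where "L = ln (t + 1)"
    define m where "m t = \<beta> * (t + 1) * ln (t + 1)" for t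
    have "(m has_real_derivative \<beta> * L + \<beta>) (at t)"
      using has_real_derivative_mean[OF that] by (simp add: m_def[abs_def] L_def)
    then have "((\<lambda>t. - m t + 2 * \<beta> * t * (t + 1) + (m t)\<^sup>2) has_real_derivative
        - (\<beta> * L + \<beta>) + 2 * \<beta> * (2 * t + 1) + 2 * m t * (\<beta> * L + \<beta>)) (at t)"
      by (auto intro!: derivative_eq_intros simp: algebra_simps)
    moreover have "- (\<beta> * L + \<beta>) + 2 * \<beta> * (2 * t + 1) + 2 * m t * (\<beta> * L + \<beta>) =
        \<beta> + (2 * \<beta> + 1 / (t + 1)) * m t + real 2 * (- m t + 2 * \<beta> * t * (t + 1) + (m t)\<^sup>2) / (t + 1)"
    proof -
      \<comment> \<open>Extracting the factor \<open>t + 1\<close> from the mean, and then from the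
        candidate solution, cancels both divisions.\<close>
      have m: "m t = (t + 1) * (\<beta> * L)" by (simp add: m_def L_def)
      have "1 / (t + 1) * m t = \<beta> * L"
        using that by (simp add: m)
      then have "(2 * \<beta> + 1 / (t + 1)) * m t = 2 * \<beta> * m t + \<beta> * L"
        by (simp only: distrib_right)
      moreover have "- m t + 2 * \<beta> * t * (t + 1) + (m t)\<^sup>2 = (t + 1) * (- (\<beta> * L) + 2 * \<beta> * t + m t * (\<beta> * L))"
        by (simp add: m power2_eq_square algebra_simps)
      then have "real 2 * (- m t + 2 * \<beta> * t * (t + 1) + (m t)\<^sup>2) / (t + 1) = 2 * (- (\<beta> * L) + 2 * \<beta> * t + m t * (\<beta> * L))"
        using that by simp
      ultimately show ?thesis
        by (simp only:) (simp add: algebra_simps)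
    qed
    ultimately show ?thesis
      by (simp only: m_def mult_minus_left)
  qed
qed (use assms \<beta>_pos m2_nonneg in \<open>auto intro!: continuous_intros add_nonneg_nonneg mult_nonneg_nonneg\<close>)

lemma expectation_N:
  assumes "0 \<le> t"
  shows "expectation (\<lambda>\<omega>. real (N t \<omega>)) = \<beta> * (t + 1) * ln (t + 1)"
  using nn_integral_N[of t] m1_nonneg[of t]
  by (subst integral_eq_nn_integral) (auto simp: m1_eq[OF assms, symmetric])

lemma variance_N:
  assumes "0 \<le> t"
  shows "variance (\<lambda>\<omega>. real (N t \<omega>)) = - \<beta> * (t + 1) * ln (t + 1) + 2 * \<beta> * t * (t + 1)"
proof -
  \<comment> \<open>Finiteness of both nonnegative integrals justifies writing the variance as the
    second moment minus the squared mean.\<close>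
  have "integrable M (\<lambda>\<omega>. real (N t \<omega>))" "integrable M (\<lambda>\<omega>. (real (N t \<omega>))\<^sup>2)"
    using nn_integral_N[of t] nn_integral_N2[of t] by (auto intro!: integrableI_nonneg)
  then have "variance (\<lambda>\<omega>. real (N t \<omega>)) =
      expectation (\<lambda>\<omega>. (real (N t \<omega>))\<^sup>2) - (expectation (\<lambda>\<omega>. real (N t \<omega>)))\<^sup>2"
    by (rule variance_eq)
  also have "expectation (\<lambda>\<omega>. (real (N t \<omega>))\<^sup>2) = m2 t"
    using nn_integral_N2[of t] m2_nonneg[of t] by (subst integral_eq_nn_integral) auto
  finally show ?thesis
    by (simp add: expectation_N m2_eq assms)
qed

end

theorem proposition17:
  fixes M :: "'a measure" and N :: "real \<Rightarrow> 'a \<Rightarrow> nat" and \<beta> :: real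
  assumes "\<beta> > 0"
    and "simple_point_process M N"
    and "has_intensity M (natural_filtration M N) N
           (\<lambda>t \<omega>. \<beta> + left_lim (\<lambda>s. real (N s \<omega>)) t / (t + 1))"
  shows "(\<forall>t\<ge>0.
            prob_space.expectation M (\<lambda>\<omega>. real (N t \<omega>)) = \<beta> * (t + 1) * ln (t + 1) \<and>
            prob_space.variance M (\<lambda>\<omega>. real (N t \<omega>)) =
              - \<beta> * (t + 1) * ln (t + 1) + 2 * \<beta> * t * (t + 1)) \<and>
         ((\<lambda>t. prob_space.variance M (\<lambda>\<omega>. real (N t \<omega>)) / t\<^sup>2) \<longlongrightarrow> 2 * \<beta>) at_top"
proof -
  interpret self_exciting_process M N \<beta>
    using assms by (simp add: self_exciting_process_def self_exciting_process_axioms_def)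
  \<comment> \<open>The logarithmic term is of smaller order than \<open>t^2\<close>, so only
    \<open>2 * \<beta> * t * (t + 1)\<close> contributes to the limit.\<close>
  have "((\<lambda>t. (- \<beta> * (t + 1) * ln (t + 1) + 2 * \<beta> * t * (t + 1)) / t\<^sup>2) \<longlongrightarrow> 2 * \<beta>) at_top"
    using \<beta>_pos by real_asymp
  moreover have "eventually (\<lambda>t. (- \<beta> * (t + 1) * ln (t + 1) + 2 * \<beta> * t * (t + 1)) / t\<^sup>2 =
      variance (\<lambda>\<omega>. real (N t \<omega>)) / t\<^sup>2) at_top"
    using eventually_ge_at_top[of 0] by eventually_elim (simp only: variance_N)
  ultimately have "((\<lambda>t. variance (\<lambda>\<omega>. real (N t \<omega>)) / t\<^sup>2) \<longlongrightarrow> 2 * \<beta>) at_top"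
    by (rule Lim_transform_eventually)
  then show ?thesis
    using expectation_N variance_N by blast
qed

end
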